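(* Let $\ell \geq 4$, and let $A$ be the part of order $\ell$ of the complete bipartite graph $K_{\ell,2}$ (so $A$ is a coclique of $\ell$ vertices of degree $2$). Then every pair of distinct vertices in $A$ is a Braess edge of $K_{\ell,2}$, but $A$ is not a Braess clique of $K_{\ell,2}$.
   Context: Graphs are finite, simple and undirected. For a connected graph $G$ with at least one edge, the random walk on $G$ has transition matrix $D^{-1}A_G$ ($A_G$ adjacency matrix, $D$ diagonal degree matrix), with stationary distribution $w_i=\deg(v_i)/(2|E(G)|)$ and mean first passage times $m_{i,j}$ ($i\ne j$). Kemeny's constant is $\mathcal{K}(G)=\sum_{j\neq i} w_j m_{i,j}$, which is independent of $i$; equivalently $\mathcal{K}(G)=\sum_{j\ge2}\frac{1}{1-\lambda_j}$ over the eigenvalues of $D^{-1}A_G$ other than the simple eigenvalue $\lambda_1=1$. A Braess clique of a connected graph $G$ is an independent set (coclique) of vertices such that the graph $\widetilde{G}$ obtained by adding all edges between these vertices satisfies $\mathcal{K}(\widetilde{G})>\mathcal{K}(G)$. A Braess edge is a Braess clique of order $2$. *)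

theory Defs
  imports
    "HOL-Probability.Probability_Mass_Function"
    "Graph_Theory.Graph_Theory"
begin

text \<open>
  A finite simple undirected graph is a \<^const>\<open>pair_graph\<close>: every undirected edge is
  represented by its two arcs.  Hence the degree of a vertex is its out-degree, and
  twice the number of edges is the number of arcs.
\<close>

definition neighbours :: "'a pair_pre_digraph \<Rightarrow> 'a \<Rightarrow> 'a set" where
  "neighbours G u = {v. (u, v) \<in> parcs G}"

text \<open>
  Row \<open>u\<close> of the transition matrix (inverse degree matrix times adjacency matrix),
  see \<open>pmf_rw_step\<close> below.  Meaningful only if \<open>u\<close> is not isolated.
\<close>

definition rw_step :: "'a pair_pre_digraph \<Rightarrow> 'a \<Rightarrow> 'a pmf" where
  "rw_step G u = pmf_of_set (neighbours G u)"

text \<open>The law of the first \<open>n\<close> steps, a list of \<open>n + 1\<close> vertices beginning with \<open>u\<close>.\<close>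

primrec random_walk :: "'a pair_pre_digraph \<Rightarrow> nat \<Rightarrow> 'a \<Rightarrow> 'a list pmf" where
  "random_walk G 0 u = return_pmf [u]"
| "random_walk G (Suc n) u =
     bind_pmf (rw_step G u) (\<lambda>v. map_pmf (Cons u) (random_walk G n v))"

definition first_passage_prob :: "'a pair_pre_digraph \<Rightarrow> 'a \<Rightarrow> 'a \<Rightarrow> nat \<Rightarrow> real" where
  "first_passage_prob G i j t =
     measure_pmf.prob (random_walk G t i) {xs. xs ! t = j \<and> (\<forall>s<t. xs ! s \<noteq> j)}"

text \<open>
  The expectation of the first passage time from \<open>i\<close> to \<open>j\<close>, for \<open>i \<noteq> j\<close>.  In a connected
  graph the first passage time is almost surely finite and the series converges.
\<close>

definition mean_first_passage :: "'a pair_pre_digraph \<Rightarrow> 'a \<Rightarrow> 'a \<Rightarrow> real" where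
  "mean_first_passage G i j = (\<Sum>t. real t * first_passage_prob G i j t)"

definition stationary :: "'a pair_pre_digraph \<Rightarrow> 'a \<Rightarrow> real" where
  "stationary G v = real (out_degree (with_proj G) v) / real (card (parcs G))"

text \<open>
  The common value of the sums below; for connected graphs it does not depend on the
  starting vertex \<open>i\<close>.
\<close>

definition kemeny :: "'a pair_pre_digraph \<Rightarrow> real" where
  "kemeny G = (THE c. \<forall>i\<in>pverts G.
     c = (\<Sum>j\<in>pverts G - {i}. stationary G j * mean_first_passage G i j))"

definition coclique :: "'a pair_pre_digraph \<Rightarrow> 'a set \<Rightarrow> bool" where
  "coclique G S \<longleftrightarrow> S \<subseteq> pverts G \<and> (\<forall>u\<in>S. \<forall>v\<in>S. (u, v) \<notin> parcs G)"

definition add_clique :: "'a pair_pre_digraph \<Rightarrow> 'a set \<Rightarrow> 'a pair_pre_digraph" where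
  "add_clique G S = G\<lparr>parcs := parcs G \<union> {(u, v). u \<in> S \<and> v \<in> S \<and> u \<noteq> v}\<rparr>"

text \<open>The qualified name avoids the topological notion of connectedness.\<close>

definition braess_clique :: "'a pair_pre_digraph \<Rightarrow> 'a set \<Rightarrow> bool" where
  "braess_clique G S \<longleftrightarrow>
     pair_graph G \<and> Digraph_Component.connected (with_proj G) \<and> coclique G S \<and>
     kemeny (add_clique G S) > kemeny G"

definition braess_edge :: "'a pair_pre_digraph \<Rightarrow> 'a \<Rightarrow> 'a \<Rightarrow> bool" where
  "braess_edge G u v \<longleftrightarrow> u \<noteq> v \<and> braess_clique G {u, v}"

text \<open>
  The library's \<^const>\<open>complete_bipartite_digraph\<close> hides the two parts behind an existential
  quantifier; this variant names them.
\<close>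

definition complete_bipartite_with_parts ::
    "'a pair_pre_digraph \<Rightarrow> 'a set \<Rightarrow> 'a set \<Rightarrow> bool" where
  "complete_bipartite_with_parts G A B \<longleftrightarrow>
     pair_graph G \<and> pverts G = A \<union> B \<and> A \<inter> B = {} \<and> parcs G = A \<times> B \<union> B \<times> A"

lemma complete_bipartite_digraph_iff_parts:
  "complete_bipartite_digraph m n (with_proj G) \<longleftrightarrow>
     (\<exists>A B. complete_bipartite_with_parts G A B \<and> card A = m \<and> card B = n)"
proof
  assume L: "complete_bipartite_digraph m n (with_proj G)"
  then have "pair_graph G" by (rule pair_graphI_complete_bipartite)
  with L show "\<exists>A B. complete_bipartite_with_parts G A B \<and> card A = m \<and> card B = n"
    unfolding complete_bipartite_digraph_pair_def complete_bipartite_with_parts_def by blast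
next
  assume R: "\<exists>A B. complete_bipartite_with_parts G A B \<and> card A = m \<and> card B = n"
  then have "pair_graph G" unfolding complete_bipartite_with_parts_def by blast
  then have "finite (pverts G)"
    by (simp add: pair_graph_def pair_digraph_def pair_fin_digraph.pair_finite_verts)
  with R show "complete_bipartite_digraph m n (with_proj G)"
    unfolding complete_bipartite_digraph_pair_def complete_bipartite_with_parts_def by blast
qed

lemma out_degree_eq_card_neighbours:
  "out_degree (with_proj G) u = card (neighbours G u)"
proof -
  have "out_arcs (with_proj G) u = Pair u ` neighbours G u"
    by (auto simp: out_arcs_def neighbours_def)
  then show ?thesis
    by (simp add: out_degree_def card_image inj_on_def)
qed

lemma finite_neighbours:
  assumes "pair_graph G"
  shows "finite (neighbours G u)"
proof -
  interpret pair_graph G by fact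
  have "neighbours G u \<subseteq> pverts G"
    by (auto simp: neighbours_def dest: in_arcsD2)
  then show ?thesis
    using pair_finite_verts by (rule finite_subset)
qed

lemma pmf_rw_step:
  assumes "pair_graph G" "neighbours G u \<noteq> {}"
  shows "pmf (rw_step G u) v =
    (if (u, v) \<in> parcs G then 1 / real (out_degree (with_proj G) u) else 0)"
  using assms finite_neighbours[OF assms(1), of u]
  by (simp add: rw_step_def pmf_of_set out_degree_eq_card_neighbours indicator_def)
     (simp add: neighbours_def)

end

theory Submission
  imports Defs
begin

text \<open>
  The mean first passage times to a fixed target are the unique solution of the linear hitting
  time equations, so Kemeny's constant is certified by an explicit table of their solutions.
  Symmetry leaves few distinct entries, and solving by hand gives \<open>l + 1/2\<close> for
  \<open>K\<^bsub>l,2\<^esub>\<close>, \<open>(4 l\<^sup>2 + 5 l - 5/2) / (4 l + 2)\<close> after adding one edge, and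
  \<open>1 + (l + 1) (l\<^sup>2 + 3 l - 1) / ((l + 2) (l + 3))\<close> after completing the large part.  The first
  change is \<open>(l - 7/2) / (4 l + 2)\<close>, whose sign explains the bound \<open>l \<ge> 4\<close>; the second is negative.
\<close>

section \<open>Hitting time equations\<close>

text \<open>This is the transition operator \<open>D^{-1} A_G\<close> acting on functions of the
  vertices. The facts below about it are its linearity, monotonicity, preservation of constants and
  exchange with series.\<close>

definition neighbour_mean :: "'a pair_pre_digraph \<Rightarrow> ('a \<Rightarrow> real) \<Rightarrow> 'a \<Rightarrow> real" where
  "neighbour_mean G g i = (\<Sum>k\<in>neighbours G i. g k) / real (card (neighbours G i))"

lemma measure_bind_pmf:
  "measure_pmf.prob (bind_pmf M f) X = (\<integral>x. measure_pmf.prob (f x) X \<partial>measure_pmf M)"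
  unfolding measure_pmf_bind
  by (rule measure_pmf.measure_bind[where N="count_space UNIV"])
     (auto intro: measure_pmf_in_subprob_algebra)

lemma first_passage_prob_0: "first_passage_prob G i j 0 = (if i = j then 1 else 0)"
  by (simp add: first_passage_prob_def)

text \<open>First-step decomposition: condition on the first neighbour visited. A walk that starts
  on the target has its first passage at time 0, hence at no later time.\<close>

lemma first_passage_prob_Suc:
  assumes "finite (neighbours G i)" "neighbours G i \<noteq> {}"
  shows "first_passage_prob G i j (Suc t) =
    (if i = j then 0 else neighbour_mean G (\<lambda>k. first_passage_prob G k j t) i)"
proof -
  let ?X = "\<lambda>t. {xs. xs ! t = j \<and> (\<forall>s<t. xs ! s \<noteq> j)}"
  \<comment> \<open>Prepending the start shifts all positions by one, so the event at time
    \<open>Suc t\<close> pulls back to the event at time \<open>t\<close>, unless the start is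
    itself a forbidden visit to \<open>j\<close>.\<close>
  have "Cons i -` ?X (Suc t) = (if i = j then {} else ?X t)"
    by (auto simp: All_less_Suc2)
  then show ?thesis
    using assms
    by (simp add: first_passage_prob_def measure_bind_pmf rw_step_def integral_pmf_of_set
        neighbour_mean_def)
qed

lemma neighbour_mean_mono:
  assumes "\<And>k. k \<in> neighbours G i \<Longrightarrow> f k \<le> g k"
  shows "neighbour_mean G f i \<le> neighbour_mean G g i"
  unfolding neighbour_mean_def by (intro divide_right_mono sum_mono assms) auto

lemma neighbour_mean_cmult: "neighbour_mean G (\<lambda>k. c * f k) i = c * neighbour_mean G f i"
  by (simp add: neighbour_mean_def sum_distrib_left)

lemma neighbour_mean_add:
  "neighbour_mean G (\<lambda>k. f k + g k) i = neighbour_mean G f i + neighbour_mean G g i"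
  by (simp add: neighbour_mean_def sum.distrib add_divide_distrib)

lemma neighbour_mean_diff:
  "neighbour_mean G (\<lambda>k. f k - g k) i = neighbour_mean G f i - neighbour_mean G g i"
  by (simp add: neighbour_mean_def sum_subtractf diff_divide_distrib)

lemma neighbour_mean_const:
  assumes "finite (neighbours G i)" "neighbours G i \<noteq> {}"
  shows "neighbour_mean G (\<lambda>_. c) i = c"
  using assms by (simp add: neighbour_mean_def)

lemma abs_neighbour_mean_le: "\<bar>neighbour_mean G f i\<bar> \<le> neighbour_mean G (\<lambda>k. \<bar>f k\<bar>) i"
  by (simp add: neighbour_mean_def abs_divide divide_right_mono)

lemma neighbour_mean_suminf:
  assumes "\<And>k. k \<in> neighbours G i \<Longrightarrow> summable (\<lambda>t. f t k)"
  shows "(\<Sum>t. neighbour_mean G (f t) i) = neighbour_mean G (\<lambda>k. \<Sum>t. f t k) i"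
  using assms unfolding neighbour_mean_def
  by (simp add: suminf_divide summable_sum suminf_sum)

lemma neighbours_subset_verts:
  assumes "pair_graph G"
  shows "neighbours G i \<subseteq> pverts G"
proof -
  interpret pair_graph G by fact
  show ?thesis by (auto simp: neighbours_def dest: in_arcsD2)
qed

text \<open>
  A nonnegative solution \<open>h\<close> of the hitting time equations is a Lyapunov function: off the
  target, averaging lowers it by \<open>1\<close>, hence by a constant factor.  This gives both exponential
  decay of the first passage probabilities and uniqueness of solutions.
\<close>

locale hitting_solution =
  fixes G :: "'a pair_pre_digraph" and j :: 'a and h :: "'a \<Rightarrow> real"
  assumes graph: "pair_graph G"
    and neighbours_nonempty: "i \<in> pverts G \<Longrightarrow> neighbours G i \<noteq> {}"
    and target: "j \<in> pverts G" "h j = 0"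
    and nonneg: "i \<in> pverts G \<Longrightarrow> 0 \<le> h i"
    and step: "i \<in> pverts G \<Longrightarrow> i \<noteq> j \<Longrightarrow> h i = 1 + neighbour_mean G h i"
begin

lemma finite_verts: "finite (pverts G)"
  using graph by (simp add: pair_graph_def pair_digraph_def pair_fin_digraph.pair_finite_verts)

lemmas finite_nbrs = finite_neighbours[OF graph]

lemma nbr_in_verts: "k \<in> neighbours G i \<Longrightarrow> k \<in> pverts G"
  using neighbours_subset_verts[OF graph] by blast

lemma ge_1:
  assumes "i \<in> pverts G" "i \<noteq> j"
  shows "1 \<le> h i"
proof -
  have "0 \<le> neighbour_mean G h i"
    unfolding neighbour_mean_def by (intro divide_nonneg_nonneg sum_nonneg nonneg nbr_in_verts) auto
  then show ?thesis using step[OF assms] by simp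
qed

text \<open>With \<open>H = 1 + (sum of all h i)\<close>, which is positive and exceeds every
  \<open>h i\<close>, the bound \<open>h i - 1 <= (1 - 1/H) * h i\<close> holds uniformly.\<close>

definition rate :: real where
  "rate = 1 - 1 / (1 + (\<Sum>i\<in>pverts G. h i))"

lemma rate: "0 \<le> rate" "rate < 1"
proof -
  have "0 \<le> (\<Sum>i\<in>pverts G. h i)" by (intro sum_nonneg nonneg)
  then show "0 \<le> rate" "rate < 1" by (simp_all add: rate_def)
qed

lemma neighbour_mean_contract:
  assumes i: "i \<in> pverts G" "i \<noteq> j" and M: "0 \<le> M"
    and f: "\<And>k. k \<in> pverts G \<Longrightarrow> \<bar>f k\<bar> \<le> M * h k"
  shows "\<bar>neighbour_mean G f i\<bar> \<le> M * rate * h i"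
proof -
  let ?H = "1 + (\<Sum>i\<in>pverts G. h i)"
  have "h i \<le> (\<Sum>i\<in>pverts G. h i)"
    by (rule member_le_sum) (use i finite_verts nonneg in auto)
  then have *: "h i \<le> ?H" and pos: "0 < ?H" using nonneg[OF i(1)] by auto
  have "\<bar>neighbour_mean G f i\<bar> \<le> neighbour_mean G (\<lambda>k. M * h k) i"
    by (rule order_trans[OF abs_neighbour_mean_le neighbour_mean_mono]) (intro f nbr_in_verts)
  also have "\<dots> = M * (h i - 1)"
    using step[OF i] by (simp add: neighbour_mean_cmult)
  \<comment> \<open>After cancelling \<open>M\<close>, this is \<open>h i <= ?H\<close>.\<close>
  also have "\<dots> \<le> M * (rate * h i)"
    using * pos by (intro mult_left_mono M) (simp add: rate_def algebra_simps)
  finally show ?thesis by (simp add: mult.assoc)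
qed

text \<open>Off the target \<open>1 <= h i\<close>, so \<open>d\<close> is bounded by a multiple of
  \<open>h\<close>; each use of harmonicity improves the bound by the factor \<open>rate\<close>,
  and the limit is 0. It is applied to the defect of total probability and to the error in the
  expected time.\<close>

lemma harmonic_eq_0:
  assumes d: "d j = 0" "\<And>i. i \<in> pverts G \<Longrightarrow> i \<noteq> j \<Longrightarrow> d i = neighbour_mean G d i"
    and i: "i \<in> pverts G"
  shows "d i = 0"
proof -
  define M where "M = (\<Sum>i\<in>pverts G. \<bar>d i\<bar>)"
  have M: "0 \<le> M" by (simp add: M_def sum_nonneg)
  have bound: "\<bar>d i\<bar> \<le> M * rate ^ n * h i" if "i \<in> pverts G" for i n
    using that
  proof (induction n arbitrary: i)
    case 0
    have "\<bar>d i\<bar> \<le> M"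
      unfolding M_def by (rule member_le_sum) (use 0 finite_verts in auto)
    then show ?case
      using M ge_1[OF 0] d(1) target
      by (cases "i = j") (auto intro: order_trans mult_left_mono[of 1 "h i" M, simplified])
  next
    case (Suc n)
    show ?case
    proof (cases "i = j")
      case False
      have "\<bar>neighbour_mean G d i\<bar> \<le> M * rate ^ n * rate * h i"
        by (rule neighbour_mean_contract) (use Suc False M rate in auto)
      then show ?thesis using d(2)[OF Suc.prems False] by (simp add: mult_ac)
    qed (use d(1) target in simp)
  qed
  have "(\<lambda>n. M * rate ^ n * h i) \<longlonglongrightarrow> M * 0 * h i"
    by (intro tendsto_intros LIMSEQ_realpow_zero rate)
  then have "\<bar>d i\<bar> \<le> 0"
    by (intro LIMSEQ_le_const[of _ 0 "\<bar>d i\<bar>"]) (use bound[OF i] in auto)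
  then show ?thesis by simp
qed

section \<open>Decay and summation of first passage probabilities\<close>

abbreviation fp :: "nat \<Rightarrow> 'a \<Rightarrow> real" where
  "fp t i \<equiv> first_passage_prob G i j t"

lemma fp_Suc:
  assumes "i \<in> pverts G"
  shows "fp (Suc t) i = (if i = j then 0 else neighbour_mean G (fp t) i)"
  using first_passage_prob_Suc[OF finite_nbrs neighbours_nonempty[OF assms]] .

lemma fp_nonneg: "0 \<le> fp t i" and fp_le_1: "fp t i \<le> 1"
  by (simp_all add: first_passage_prob_def)

text \<open>The bound starts at time 1 because at time 0 the probability on the target is 1 whereas
  \<open>h j = 0\<close>. At time 1, off the target, \<open>fp <= 1 <= h\<close> suffices; later
  times follow by contraction.\<close>

lemma fp_decay:
  assumes "i \<in> pverts G"
  shows "fp (Suc t) i \<le> rate ^ t * h i"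
  using assms
proof (induction t arbitrary: i)
  case 0
  then show ?case
    using ge_1[OF 0] target fp_le_1[of i 1] fp_Suc[OF 0, of 0]
    by (cases "i = j") (simp_all del: One_nat_def add: One_nat_def[symmetric])
next
  case (Suc t)
  show ?case
  proof (cases "i = j")
    case False
    have "\<bar>neighbour_mean G (fp (Suc t)) i\<bar> \<le> rate ^ t * rate * h i"
      by (rule neighbour_mean_contract) (use Suc False rate fp_nonneg in auto)
    then show ?thesis using Suc.prems False by (simp add: fp_Suc mult_ac)
  qed (use Suc.prems target in \<open>simp add: fp_Suc\<close>)
qed

lemma summable_Suc_fp:
  assumes "i \<in> pverts G"
  shows "summable (\<lambda>t. real (Suc t) * fp (Suc t) i)"
proof (rule summable_comparison_test)
  \<comment> \<open>The dominating series is the derivative of the geometric series.\<close>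
  have "(\<lambda>t. real (Suc t) * rate ^ t) sums (1 / (1 - rate)\<^sup>2)"
    using geometric_deriv_sums[of rate] rate by simp
  then show "summable (\<lambda>t. real (Suc t) * rate ^ t * h i)"
    by (intro summable_mult2) (rule sums_summable)
  have "real (Suc t) * fp (Suc t) i \<le> real (Suc t) * (rate ^ t * h i)" for t
    by (intro mult_left_mono fp_decay assms) auto
  then show "\<exists>N. \<forall>n\<ge>N. norm (real (Suc n) * fp (Suc n) i) \<le> real (Suc n) * rate ^ n * h i"
    using fp_nonneg by (simp add: abs_mult mult.assoc)
qed

lemma summable_t_fp: "i \<in> pverts G \<Longrightarrow> summable (\<lambda>t. real t * fp t i)"
  using summable_Suc_fp[of i] summable_Suc_iff[of "\<lambda>t. real t * fp t i"] by simp

lemma summable_fp: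
  assumes "i \<in> pverts G"
  shows "summable (\<lambda>t. fp t i)"
proof -
  have "summable (\<lambda>t. fp (Suc t) i)"
    by (rule summable_comparison_test[OF _ summable_Suc_fp[OF assms]])
       (use fp_nonneg in \<open>auto intro!: exI[of _ 0] simp: algebra_simps\<close>)
  then show ?thesis by (simp add: summable_Suc_iff[of "\<lambda>t. fp t i"])
qed

text \<open>The target is hit almost surely: the probability of never hitting it is harmonic off
  \<open>j\<close> and vanishes at \<open>j\<close>, hence is 0 by
  \<open>harmonic_eq_0\<close>.\<close>

lemma suminf_fp:
  assumes "i \<in> pverts G"
  shows "(\<Sum>t. fp t i) = 1"
proof -
  let ?F = "\<lambda>i. \<Sum>t. fp t i"
  have shift: "?F i = fp 0 i + (\<Sum>t. fp (Suc t) i)" if "i \<in> pverts G" for i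
    using suminf_split_head[OF summable_fp[OF that]] by simp
  have "1 - ?F i = 0"
  proof (rule harmonic_eq_0[OF _ _ assms])
    show "1 - ?F j = 0"
      using shift[OF target(1)] fp_Suc[OF target(1)] by (simp add: first_passage_prob_0)
    fix k assume k: "k \<in> pverts G" "k \<noteq> j"
    have "?F k = (\<Sum>t. neighbour_mean G (fp t) k)"
      using shift[OF k(1)] fp_Suc[OF k(1)] k(2) by (simp add: first_passage_prob_0)
    also have "\<dots> = neighbour_mean G ?F k"
      by (rule neighbour_mean_suminf) (intro summable_fp nbr_in_verts)
    finally show "1 - ?F k = neighbour_mean G (\<lambda>k. 1 - ?F k) k"
      by (simp add: neighbour_mean_diff neighbour_mean_const finite_nbrs neighbours_nonempty k)
  qed
  then show ?thesis by simp
qed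

text \<open>The expected time obeys the same equations as \<open>h\<close>, so their difference is
  harmonic off \<open>j\<close> and vanishes at \<open>j\<close>.\<close>

theorem mean_first_passage_eq:
  assumes "i \<in> pverts G"
  shows "mean_first_passage G i j = h i"
proof -
  let ?F = "\<lambda>i. \<Sum>t. real t * fp t i"
  have shift: "?F i = (\<Sum>t. real (Suc t) * fp (Suc t) i)" if "i \<in> pverts G" for i
    using suminf_split_head[OF summable_t_fp[OF that]] by simp
  have "?F i - h i = 0"
  proof (rule harmonic_eq_0[OF _ _ assms])
    show "?F j - h j = 0"
      using shift[OF target(1)] fp_Suc[OF target(1)] target(2) by simp
    fix k assume k: "k \<in> pverts G" "k \<noteq> j"
    \<comment> \<open>Time \<open>Suc t\<close> splits as \<open>t + 1\<close>: the first part is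
      the expectation from the neighbours, and the second sums to 1 by \<open>suminf_fp\<close>,
      giving the constant of the hitting time equation.\<close>
    have "?F k = (\<Sum>t. neighbour_mean G (\<lambda>k. real t * fp t k + fp t k) k)"
      using shift[OF k(1)] fp_Suc[OF k(1)] k(2)
      by (simp add: neighbour_mean_add neighbour_mean_cmult algebra_simps)
    also have "\<dots> = neighbour_mean G (\<lambda>k. \<Sum>t. real t * fp t k + fp t k) k"
      by (rule neighbour_mean_suminf) (intro summable_add summable_t_fp summable_fp nbr_in_verts)
    also have "\<dots> = neighbour_mean G (\<lambda>k. ?F k + 1) k"
      unfolding neighbour_mean_def
      by (intro arg_cong2[where f="(/)"] sum.cong refl)
         (metis nbr_in_verts suminf_add summable_t_fp summable_fp suminf_fp)
    also have "\<dots> = neighbour_mean G ?F k + 1"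
      by (simp add: neighbour_mean_add neighbour_mean_const finite_nbrs neighbours_nonempty k)
    finally show "?F k - h k = neighbour_mean G (\<lambda>k. ?F k - h k) k"
      by (simp add: neighbour_mean_diff step k)
  qed
  then show ?thesis by (simp add: mean_first_passage_def)
qed

end

section \<open>Kemeny's constant from a table of hitting times\<close>

lemma card_parcs_eq_sum_neighbours:
  assumes "pair_graph G"
  shows "card (parcs G) = (\<Sum>i\<in>pverts G. card (neighbours G i))"
proof -
  interpret pair_graph G by fact
  have "parcs G = (SIGMA i:pverts G. neighbours G i)"
    by (auto simp: neighbours_def dest: in_arcsD1)
  then show ?thesis
    using pair_finite_verts finite_neighbours[OF assms] by simp
qed

text \<open>The equations are multiplied by the degrees, so that no quotients occur.\<close>

lemma kemeny_eqI:
  fixes m :: "'a \<Rightarrow> 'a \<Rightarrow> real"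
  assumes G: "pair_graph G" "pverts G \<noteq> {}" "\<And>i. i \<in> pverts G \<Longrightarrow> neighbours G i \<noteq> {}"
    and m_diag: "\<And>j. j \<in> pverts G \<Longrightarrow> m j j = 0"
    and m_nonneg: "\<And>i j. i \<in> pverts G \<Longrightarrow> j \<in> pverts G \<Longrightarrow> 0 \<le> m i j"
    and m_step: "\<And>i j. i \<in> pverts G \<Longrightarrow> j \<in> pverts G \<Longrightarrow> i \<noteq> j \<Longrightarrow>
      card (neighbours G i) * m i j = card (neighbours G i) + (\<Sum>k\<in>neighbours G i. m k j)"
    and total: "\<And>i. i \<in> pverts G \<Longrightarrow>
      (\<Sum>j\<in>pverts G. card (neighbours G j) * m i j) =
      c * real (\<Sum>j\<in>pverts G. card (neighbours G j))"
  shows "kemeny G = c"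
proof -
  interpret pair_graph G by fact
  have deg: "card (neighbours G i) > 0" if "i \<in> pverts G" for i
    using G(3)[OF that] finite_neighbours[OF G(1)] by (simp add: card_gt_0_iff)
  have arcs: "card (parcs G) > 0"
    unfolding card_parcs_eq_sum_neighbours[OF G(1)]
    using G(2) deg by (intro sum_pos pair_finite_verts) auto
  have mfp: "mean_first_passage G i j = m i j" if ij: "i \<in> pverts G" "j \<in> pverts G" for i j
  proof -
    \<comment> \<open>Each column of the table solves the hitting time equations of its own
      target.\<close>
    interpret hitting_solution G j "\<lambda>i. m i j"
    proof (rule hitting_solution.intro)
      show "pair_graph G" by fact
      show "m i j = 1 + neighbour_mean G (\<lambda>i. m i j) i" if "i \<in> pverts G" "i \<noteq> j" for i
        using m_step[OF that(1) ij(2) that(2)] deg[OF that(1)]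
        by (simp add: neighbour_mean_def field_simps)
    qed (use G m_diag m_nonneg ij in auto)
    show ?thesis using ij by (rule_tac mean_first_passage_eq)
  qed
  have sum_eq: "(\<Sum>j\<in>pverts G - {i}. stationary G j * mean_first_passage G i j) = c"
    if i: "i \<in> pverts G" for i
  proof -
    have "(\<Sum>j\<in>pverts G - {i}. stationary G j * mean_first_passage G i j) =
        (\<Sum>j\<in>pverts G - {i}. card (neighbours G j) * m i j / card (parcs G))"
      by (intro sum.cong refl) (simp add: stationary_def out_degree_eq_card_neighbours mfp i)
    \<comment> \<open>The term \<open>j = i\<close> may be restored since the diagonal of
      \<open>m\<close> is 0.\<close>
    also have "\<dots> = (\<Sum>j\<in>pverts G. card (neighbours G j) * m i j / card (parcs G))"
      using sum.remove[OF pair_finite_verts i,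
        of "\<lambda>j. card (neighbours G j) * m i j / card (parcs G)"] m_diag[OF i] by simp
    also have "\<dots> = c"
      using arcs total[OF i]
      by (auto simp flip: sum_divide_distrib card_parcs_eq_sum_neighbours[OF G(1)] of_nat_sum)
    finally show ?thesis .
  qed
  show ?thesis
    \<comment> \<open>As there is at least one vertex, \<open>c\<close> is the only value satisfying
      the condition of the \<open>THE\<close>.\<close>
    unfolding kemeny_def by (rule the_equality) (use sum_eq G(2) in auto)
qed

section \<open>Adding a clique, and sums over a symmetry class\<close>

lemma pair_graph_add_clique:
  assumes "pair_graph G" "S \<subseteq> pverts G"
  shows "pair_graph (add_clique G S)"
proof -
  interpret pair_graph G by fact
  have "finite (S \<times> S)"
    using assms(2) pair_finite_verts by (meson finite_SigmaI finite_subset)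
  moreover have "{(u, v). u \<in> S \<and> v \<in> S \<and> u \<noteq> v} \<subseteq> S \<times> S" by auto
  ultimately have "finite {(u, v). u \<in> S \<and> v \<in> S \<and> u \<noteq> v}" by (rule rev_finite_subset)
  moreover have "sym (parcs G)" using pair_sym_arcs by (simp add: symmetric_def)
  ultimately show ?thesis
    using assms(2) pair_finite_verts pair_finite_arcs
    by unfold_locales
       (auto simp: add_clique_def symmetric_def sym_def dest: in_arcsD1 in_arcsD2 pair_no_loops)
qed

lemma neighbours_add_clique:
  "neighbours (add_clique G S) i = neighbours G i \<union> (if i \<in> S then S - {i} else {})"
  by (auto simp: neighbours_def add_clique_def)

lemma pverts_add_clique: "pverts (add_clique G S) = pverts G"
  by (simp add: add_clique_def)

text \<open>Meant for rows and columns of a hitting time table within one symmetry class, where all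
  entries off the diagonal agree.\<close>

lemma sum_eq_const_except:
  fixes g :: "'a \<Rightarrow> real"
  assumes "finite S" "s \<in> S" "\<And>k. k \<in> S \<Longrightarrow> k \<noteq> s \<Longrightarrow> g k = x"
  shows "sum g S = g s + (real (card S) - 1) * x"
proof -
  have "sum g (S - {s}) = (\<Sum>k\<in>S - {s}. x)" using assms by (intro sum.cong) auto
  then show ?thesis
    using assms card_gt_0_iff[of S] by (subst sum.remove[of S s]) (auto simp: of_nat_diff)
qed


section \<open>The three graphs\<close>

lemma connected_complete_bipartite:
  assumes G: "complete_bipartite_with_parts G A B" and ne: "A \<noteq> {}" "B \<noteq> {}"
  shows "Digraph_Component.connected (with_proj G)"
proof -
  interpret pair_graph G using G by (simp add: complete_bipartite_with_parts_def)
  have V: "pverts G = A \<union> B" and E: "parcs G = A \<times> B \<union> B \<times> A"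
    using G by (auto simp: complete_bipartite_with_parts_def)
  obtain a b where ab: "a \<in> A" "b \<in> B" using ne by blast
  have adj: "u \<rightarrow>\<^sup>*\<^bsub>with_proj G\<^esub> v" if "(u, v) \<in> A \<times> B \<union> B \<times> A" for u v
    using that E by (intro reachable_adjI) simp
  \<comment> \<open>Everything is routed through the fixed vertex \<open>a\<close>; vertices of
    \<open>A\<close> get there and back by way of \<open>b\<close>.\<close>
  have to: "u \<rightarrow>\<^sup>*\<^bsub>with_proj G\<^esub> a" and "from": "a \<rightarrow>\<^sup>*\<^bsub>with_proj G\<^esub> u" if "u \<in> A \<union> B" for u
    using that ab reachable_trans[OF adj[of u b] adj[of b a]]
      reachable_trans[OF adj[of a b] adj[of b u]] adj[of u a] adj[of a u] by blast+
  have "u \<rightarrow>\<^sup>*\<^bsub>mk_symmetric (with_proj G)\<^esub> v" if "u \<in> A \<union> B" "v \<in> A \<union> B" for u v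
    using reachable_trans[OF to[OF that(1)] "from"[OF that(2)]] by (rule reachable_mk_symmetricI)
  then show ?thesis
    unfolding Digraph_Component.connected_def strongly_connected_def using ne V by simp
qed

locale bipartite_two =
  fixes G :: "'a pair_pre_digraph" and A B :: "'a set" and l :: nat
  assumes l: "4 \<le> l"
    and G: "complete_bipartite_with_parts G A B"
    and cards: "card A = l" "card B = 2"
begin

lemma fin: "finite A" "finite B"
  using cards l by (auto intro: card_ge_0_finite)

lemma nonempty: "A \<noteq> {}" "B \<noteq> {}"
  using cards l by auto

lemma pair_graph: "pair_graph G" and verts: "pverts G = A \<union> B" and disj: "A \<inter> B = {}"
  and arcs: "parcs G = A \<times> B \<union> B \<times> A"
  using G by (auto simp: complete_bipartite_with_parts_def)

lemma coclique: "S \<subseteq> A \<Longrightarrow> coclique G S"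
  using disj by (auto simp: coclique_def verts arcs)

lemma nbrs: "i \<in> A \<Longrightarrow> neighbours G i = B" "i \<in> B \<Longrightarrow> neighbours G i = A"
  using disj by (auto simp: neighbours_def arcs)

lemma sum_verts: "sum g (pverts G) = sum g A + sum g B"
  using fin disj by (simp add: verts sum.union_disjoint)

lemma l_real: "4 \<le> real l"
  using l by simp

section \<open>Kemeny's constant of the bipartite graph\<close>

lemma kemeny_eq: "kemeny G = real l + 1 / 2"
proof -
  \<comment> \<open>Let \<open>x\<close>, \<open>y\<close> be the times from \<open>A\<close> and
    \<open>B\<close>. A target in \<open>B\<close> gives \<open>x = 1 + y/2\<close>,
    \<open>y = 1 + x\<close>; a target in \<open>A\<close> gives \<open>x = 1 + y\<close>,
    \<open>l*y = l + (l-1)*x\<close>.\<close>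
  define m :: "'a \<Rightarrow> 'a \<Rightarrow> real" where
    "m i j = (if i = j then 0
      else if j \<in> B then (if i \<in> A then 3 else 4)
      else (if i \<in> A then 2 * l else 2 * real l - 1))" for i j
  have mAB: "m i j = 3" "m j i = 2 * real l - 1" if "i \<in> A" "j \<in> B" for i j
    using that disj by (auto simp: m_def)
  have mAA: "m i j = 2 * l" if "i \<in> A" "j \<in> A" "i \<noteq> j" for i j
    using that disj by (auto simp: m_def)
  have mBB: "m i j = 4" if "i \<in> B" "j \<in> B" "i \<noteq> j" for i j
    using that disj by (auto simp: m_def)
  have m0: "m i i = 0" for i by (simp add: m_def)
  have colA: "(\<Sum>k\<in>A. m k j) = (real l - 1) * (2 * l)" if "j \<in> A" for j
    using sum_eq_const_except[OF fin(1) that, of "\<lambda>k. m k j"] mAA that m0 cards by simp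
  have rowA: "(\<Sum>k\<in>A. m j k) = (real l - 1) * (2 * l)" if "j \<in> A" for j
    using sum_eq_const_except[OF fin(1) that, of "m j"] mAA that m0 cards by simp
  have colB: "(\<Sum>k\<in>B. m k j) = 4" if "j \<in> B" for j
    using sum_eq_const_except[OF fin(2) that, of "\<lambda>k. m k j"] mBB that m0 cards by simp
  have rowB: "(\<Sum>k\<in>B. m j k) = 4" if "j \<in> B" for j
    using sum_eq_const_except[OF fin(2) that, of "m j"] mBB that m0 cards by simp
  show ?thesis
  proof (rule kemeny_eqI[of G m])
    fix i j assume ij: "i \<in> pverts G" "j \<in> pverts G"
    show "0 \<le> m i j" using l by (simp add: m_def)
    assume "i \<noteq> j"
    then show "card (neighbours G i) * m i j
        = card (neighbours G i) + (\<Sum>k\<in>neighbours G i. m k j)"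
      using ij l_real
      by (auto simp: verts nbrs cards mAB mAA mBB colA colB algebra_simps)
  next
    fix i assume "i \<in> pverts G"
    then consider "i \<in> A" | "i \<in> B" by (auto simp: verts)
    then show "(\<Sum>j\<in>pverts G. card (neighbours G j) * m i j)
        = (real l + 1 / 2) * real (\<Sum>j\<in>pverts G. card (neighbours G j))"
      by cases (simp_all add: sum_verts nbrs cards rowA rowB mAB algebra_simps
          flip: sum_distrib_left)
  qed (use pair_graph nonempty verts nbrs m0 in auto)
qed

section \<open>Kemeny's constant after adding one edge\<close>

lemma kemeny_add_edge:
  assumes uv: "u \<in> A" "v \<in> A" "u \<noteq> v"
  shows "kemeny (add_clique G {u, v}) = (4 * real l ^ 2 + 5 * l - 5 / 2) / (4 * l + 2)"
proof -
  let ?G = "add_clique G {u, v}"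
  \<comment> \<open>The symmetry classes are the endpoints \<open>U\<close> of the new edge, the
    rest \<open>C\<close> of \<open>A\<close>, and \<open>B\<close>; off the diagonal, hitting times
    depend only on the classes.\<close>
  define U where "U = {u, v}"
  define C where "C = A - U"
  have finU: "finite U" "finite C" using fin by (auto simp: U_def C_def)
  have A: "A = U \<union> C" and UC: "U \<inter> C = {}" and UB: "U \<inter> B = {}" and CB: "C \<inter> B = {}"
    using uv disj by (auto simp: U_def C_def)
  have cardU: "card U = 2" using uv by (simp add: U_def)
  have cardC: "real (card C) = real l - 2"
    using uv l cards fin by (simp add: C_def U_def card_Diff_subset of_nat_diff)
  have V: "pverts ?G = U \<union> C \<union> B" by (simp add: pverts_add_clique verts A)
  have sumA: "sum g A = sum g U + sum g C" for g :: "'a \<Rightarrow> real"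
    unfolding A using finU UC by (simp add: sum.union_disjoint)
  have sumV: "sum g (U \<union> C \<union> B) = sum g U + sum g C + sum g B" for g :: "'a \<Rightarrow> real"
    using sum_verts[of g] by (simp add: verts A[symmetric] sumA)
  \<comment> \<open>For an endpoint \<open>i\<close> of the new edge, \<open>x i\<close> is the
    other endpoint.\<close>
  define x where "x i = (if i = u then v else u)" for i
  have x: "x i \<in> U" "x i \<noteq> i" "x i \<notin> B" if "i \<in> U" for i
    using that UB uv by (auto simp: x_def U_def)
  have nU: "neighbours ?G i = insert (x i) B" if "i \<in> U" for i
    using that uv nbrs(1) by (auto simp: neighbours_add_clique x_def U_def)
  have nC: "neighbours ?G i = B" if "i \<in> C" for i
    using that nbrs(1) by (auto simp: neighbours_add_clique C_def U_def)
  have nB: "neighbours ?G i = A" if "i \<in> B" for i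
    using that nbrs(2) UB by (auto simp: neighbours_add_clique U_def)
  have degU: "card (neighbours ?G i) = 3" if "i \<in> U" for i
    using that x fin cards by (simp add: nU)
  note deg = degU nC nB cards
  have deg_sum: "(\<Sum>j\<in>pverts ?G. card (neighbours ?G j) * g j)
      = 3 * sum g U + 2 * sum g C + l * sum g B" for g :: "'a \<Rightarrow> real"
    by (simp add: V sumV deg flip: sum_distrib_left)
  \<comment> \<open>Let \<open>p\<close>, \<open>q\<close>, \<open>r\<close> be the times from
    \<open>U\<close>, \<open>C\<close>, \<open>B\<close>. A target in \<open>B\<close> gives
    \<open>2*p = 3 + r\<close>, \<open>2*q = 2 + r\<close>, \<open>l*r = l + 2*p + (l-2)*q\<close>.
    One in \<open>U\<close> gives \<open>3*p = 3 + 2*r\<close>, \<open>q = 1 + r\<close>,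
    \<open>l*r = l + p + (l-2)*q\<close>. One in \<open>C\<close> gives
    \<open>2*p = 3 + 2*r\<close>, \<open>q = 1 + r\<close>,
    \<open>l*r = l + 2*p + (l-3)*q\<close>.\<close>
  define m :: "'a \<Rightarrow> 'a \<Rightarrow> real" where
    "m i j = (if i = j then 0
      else if j \<in> B then
        (if i \<in> U then (7 * l + 2) / (2 * l) else if i \<in> C then (3 * l + 1) / l else (4 * l + 2) / l)
      else if j \<in> U then
        (if i \<in> U then l + 1 / 2 else if i \<in> C then (6 * l + 1) / 4 else (6 * real l - 3) / 4)
      else
        (if i \<in> U then 2 * l + 3 / 2 else if i \<in> C then 2 * l + 1 else 2 * l))" for i j
  have m0: "m i i = 0" for i by (simp add: m_def)
  have mU: "i \<in> U \<Longrightarrow> i \<noteq> j \<Longrightarrow> m i j = l + 1 / 2"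
    "i \<in> C \<Longrightarrow> m i j = (6 * l + 1) / 4" "i \<in> B \<Longrightarrow> m i j = (6 * real l - 3) / 4"
    if "j \<in> U" for i j
    using that UC UB CB by (auto simp: m_def)
  have mC: "i \<in> U \<Longrightarrow> m i j = 2 * l + 3 / 2"
    "i \<in> C \<Longrightarrow> i \<noteq> j \<Longrightarrow> m i j = 2 * l + 1" "i \<in> B \<Longrightarrow> m i j = 2 * l"
    if "j \<in> C" for i j
    using that UC UB CB by (auto simp: m_def)
  have mB: "i \<in> U \<Longrightarrow> m i j = (7 * l + 2) / (2 * l)"
    "i \<in> C \<Longrightarrow> m i j = (3 * l + 1) / l" "i \<in> B \<Longrightarrow> i \<noteq> j \<Longrightarrow> m i j = (4 * l + 2) / l"
    if "j \<in> B" for i j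
    using that UC UB CB by (auto simp: m_def)
  have UU: "(\<Sum>k\<in>U. m k j) = l + 1 / 2" "(\<Sum>k\<in>U. m j k) = l + 1 / 2" if "j \<in> U" for j
    using sum_eq_const_except[OF finU(1) that, of "\<lambda>k. m k j" "l + 1 / 2"]
      sum_eq_const_except[OF finU(1) that, of "m j" "l + 1 / 2"] mU that m0 cardU by simp_all
  have CC: "(\<Sum>k\<in>C. m k j) = (real l - 3) * (2 * l + 1)"
    "(\<Sum>k\<in>C. m j k) = (real l - 3) * (2 * l + 1)" if "j \<in> C" for j
    using sum_eq_const_except[OF finU(2) that, of "\<lambda>k. m k j" "2 * l + 1"]
      sum_eq_const_except[OF finU(2) that, of "m j" "2 * l + 1"] mC that m0 cardC by simp_all
  have BB: "(\<Sum>k\<in>B. m k j) = (4 * l + 2) / l" "(\<Sum>k\<in>B. m j k) = (4 * l + 2) / l"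
    if "j \<in> B" for j
    using sum_eq_const_except[OF fin(2) that, of "\<lambda>k. m k j" "(4 * l + 2) / l"]
      sum_eq_const_except[OF fin(2) that, of "m j" "(4 * l + 2) / l"] mB that m0 cards by simp_all
  show ?thesis
  proof (rule kemeny_eqI[of ?G m])
    show "pair_graph ?G"
      using uv pair_graph verts by (intro pair_graph_add_clique) auto
    fix i j assume ij: "i \<in> pverts ?G" "j \<in> pverts ?G"
    show "0 \<le> m i j" using l by (simp add: m_def)
    assume ne: "i \<noteq> j"
    from ij consider "i \<in> U" | "i \<in> C" | "i \<in> B" by (auto simp: V)
    then show "card (neighbours ?G i) * m i j
        = card (neighbours ?G i) + (\<Sum>k\<in>neighbours ?G i. m k j)"
    proof cases
      case 1
      \<comment> \<open>A target in \<open>U\<close> other than \<open>i\<close> is the neighbour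
        across the new edge, so that neighbour contributes 0.\<close>
      have "x i = j" if "j \<in> U" using that 1 ne by (auto simp: x_def U_def)
      moreover have "(\<Sum>k\<in>neighbours ?G i. m k j) = m (x i) j + (\<Sum>k\<in>B. m k j)"
        using nU[OF 1] x[OF 1] fin by simp
      ultimately show ?thesis
        using 1 ij ne x[OF 1] l_real
        by (auto simp: V degU mU mC mB BB m0 cards field_simps)
    next
      case 2
      then show ?thesis
        using ij ne l_real by (auto simp: V deg mU mC mB BB m0 field_simps)
    next
      case 3
      then show ?thesis
        using ij ne l_real
        by (auto simp: V deg sumA UU CC mU mC mB m0 cardU cardC field_simps)
    qed
  next
    fix i assume "i \<in> pverts ?G"
    then consider "i \<in> U" | "i \<in> C" | "i \<in> B" by (auto simp: V)
    \<comment> \<open>The degree-weighted row sum is the same for all three classes; dividing it by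
      the total degree \<open>4*l + 2\<close> gives the claimed constant.\<close>
    then have "3 * sum (m i) U + 2 * sum (m i) C + l * sum (m i) B
        = 4 * real l ^ 2 + 5 * l - 5 / 2"
      by cases
        (use l_real in \<open>simp_all add: UU CC BB mU mC mB cardU cardC cards field_simps power2_eq_square\<close>)
    moreover have "real (\<Sum>j\<in>pverts ?G. card (neighbours ?G j)) = 4 * l + 2"
      using deg_sum[of "\<lambda>_. 1"] by (simp add: cardU cardC cards)
    ultimately show "(\<Sum>j\<in>pverts ?G. card (neighbours ?G j) * m i j)
        = (4 * real l ^ 2 + 5 * l - 5 / 2) / (4 * l + 2)
          * real (\<Sum>j\<in>pverts ?G. card (neighbours ?G j))"
      using l_real by (simp add: deg_sum)
  qed (use nonempty V nU nC nB m0 in auto)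
qed

section \<open>Kemeny's constant after completing the large part\<close>

lemma kemeny_add_part:
  "kemeny (add_clique G A) = 1 + (real l + 1) * (real l ^ 2 + 3 * real l - 1) / ((real l + 2) * (real l + 3))"
proof -
  let ?G = "add_clique G A"
  have V: "pverts ?G = A \<union> B" by (simp add: pverts_add_clique verts)
  have nA: "neighbours ?G i = (A - {i}) \<union> B" if "i \<in> A" for i
    using that nbrs(1) by (auto simp: neighbours_add_clique)
  have nB: "neighbours ?G i = A" if "i \<in> B" for i
    using that nbrs(2) disj by (auto simp: neighbours_add_clique)
  have sumA: "sum g (neighbours ?G i) = sum g A - g i + sum g B" if "i \<in> A"
    for g :: "'a \<Rightarrow> real" and i
    unfolding nA[OF that] using that fin disj
    by (subst sum.union_disjoint) (auto simp: sum_diff1)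
  have degA: "real (card (neighbours ?G i)) = real l + 1" if "i \<in> A" for i
    using sumA[OF that, of "\<lambda>_. 1"] cards by simp
  have deg_sum: "(\<Sum>j\<in>pverts ?G. card (neighbours ?G j) * g j)
      = (real l + 1) * sum g A + l * sum g B" for g :: "'a \<Rightarrow> real"
    by (simp add: V sum_verts[unfolded verts] degA nB cards flip: sum_distrib_left)
  \<comment> \<open>\<open>a\<close> and \<open>b\<close> are the times to a target in
    \<open>A\<close> from the rest of \<open>A\<close> and from \<open>B\<close>: the solution of
    the two equations in \<open>eqs\<close>.\<close>
  define a :: real where "a = real l * (real l + 3) / (real l + 2)"
  define b :: real where "b = (real l ^ 2 + 3 * real l - 1) / (real l + 2)"
  \<comment> \<open>For a target in \<open>B\<close>, the times \<open>x\<close> from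
    \<open>A\<close> and \<open>y\<close> from the other vertex of \<open>B\<close> satisfy
    \<open>2*x = l + 1 + y\<close> and \<open>y = 1 + x\<close>.\<close>
  define m :: "'a \<Rightarrow> 'a \<Rightarrow> real" where
    "m i j = (if i = j then 0
      else if j \<in> B then (if i \<in> A then real l + 2 else real l + 3)
      else (if i \<in> A then a else b))" for i j
  have m0: "m i i = 0" for i by (simp add: m_def)
  have mAA: "m i j = a" if "i \<in> A" "j \<in> A" "i \<noteq> j" for i j
    using that disj by (auto simp: m_def)
  have mBB: "m i j = real l + 3" if "i \<in> B" "j \<in> B" "i \<noteq> j" for i j
    using that disj by (auto simp: m_def)
  have mAB: "m i j = real l + 2" "m j i = b" if "i \<in> A" "j \<in> B" for i j
    using that disj by (auto simp: m_def)
  have AA: "(\<Sum>k\<in>A. m k j) = (real l - 1) * a" "(\<Sum>k\<in>A. m j k) = (real l - 1) * a"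
    if "j \<in> A" for j
    using sum_eq_const_except[OF fin(1) that, of "\<lambda>k. m k j" a]
      sum_eq_const_except[OF fin(1) that, of "m j" a] mAA that m0 cards by simp_all
  have BB: "(\<Sum>k\<in>B. m k j) = real l + 3" "(\<Sum>k\<in>B. m j k) = real l + 3" if "j \<in> B" for j
    using sum_eq_const_except[OF fin(2) that, of "\<lambda>k. m k j" "real l + 3"]
      sum_eq_const_except[OF fin(2) that, of "m j" "real l + 3"] mBB that m0 cards by simp_all
  \<comment> \<open>The hitting time equations at a vertex of \<open>A\<close> and of
    \<open>B\<close>; in the first, \<open>(l-2)*a\<close> from the other non-target vertices of
    \<open>A\<close> is cancelled against \<open>(l+1)*a\<close>.\<close>
  have eqs: "3 * a = real l + 1 + 2 * b" "l * b = real l + (real l - 1) * a"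
    using l_real by (simp_all add: a_def b_def field_simps power2_eq_square)
  show ?thesis
  proof (rule kemeny_eqI[of ?G m])
    show "pair_graph ?G"
      using pair_graph verts by (intro pair_graph_add_clique) auto
    fix i j assume ij: "i \<in> pverts ?G" "j \<in> pverts ?G"
    have "0 \<le> b"
      unfolding b_def using l_real zero_le_power2[of "real l"]
      by (intro divide_nonneg_nonneg) (linarith, simp)
    then show "0 \<le> m i j" by (simp add: m_def a_def)
    assume "i \<noteq> j"
    then show "card (neighbours ?G i) * m i j
        = card (neighbours ?G i) + (\<Sum>k\<in>neighbours ?G i. m k j)"
      using ij eqs
      by (auto simp: V sumA degA nB cards mAB mAA mBB AA BB m0 algebra_simps)
  next
    fix i assume "i \<in> pverts ?G"
    then consider "i \<in> A" | "i \<in> B" by (auto simp: V)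
    \<comment> \<open>The right side is the row sum of a vertex in \<open>B\<close>; rows of
      \<open>A\<close> agree with it. Its first summand equals the total degree and yields the
      leading 1 of the constant.\<close>
    then have "(real l + 1) * sum (m i) A + l * sum (m i) B
        = real l * (real l + 3) + (real l + 1) * real l * b"
      by cases (use l_real in
        \<open>simp_all add: AA BB mAB cards a_def b_def field_simps power2_eq_square\<close>)
    moreover have "real (\<Sum>j\<in>pverts ?G. card (neighbours ?G j)) = real l * (real l + 3)"
      using deg_sum[of "\<lambda>_. 1"] by (simp add: cards algebra_simps)
    moreover have "real l * (real l + 3) + (real l + 1) * real l * b
        = (1 + (real l + 1) * b / (real l + 3)) * (real l * (real l + 3))"
      by (simp add: field_simps)
    moreover have "(real l + 1) * (real l ^ 2 + 3 * real l - 1) / ((real l + 2) * (real l + 3))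
        = (real l + 1) * b / (real l + 3)"
      by (simp add: b_def)
    ultimately show "(\<Sum>j\<in>pverts ?G. card (neighbours ?G j) * m i j)
        = (1 + (real l + 1) * (real l ^ 2 + 3 * real l - 1) / ((real l + 2) * (real l + 3)))
          * real (\<Sum>j\<in>pverts ?G. card (neighbours ?G j))"
      by (simp only: deg_sum)
  qed (use nonempty V nA nB m0 in auto)
qed

end

section \<open>Comparison of the three constants\<close>

theorem theorem5p1:
  fixes G :: "'a pair_pre_digraph" and A B :: "'a set" and l :: nat
  assumes "l \<ge> 4"
    and "complete_bipartite_with_parts G A B"
    and "card A = l" and "card B = 2"
  shows "(\<forall>u\<in>A. \<forall>v\<in>A. u \<noteq> v \<longrightarrow> braess_edge G u v) \<and> \<not> braess_clique G A"
proof -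
  interpret bipartite_two G A B l using assms by unfold_locales
  have connected: "Digraph_Component.connected (with_proj G)"
    using G nonempty by (rule connected_complete_bipartite)
  have edge: "kemeny G < kemeny (add_clique G {u, v})"
    if "u \<in> A" "v \<in> A" "u \<noteq> v" for u v
    unfolding kemeny_eq kemeny_add_edge[OF that] using l_real
    by (simp add: field_simps power2_eq_square)
  \<comment> \<open>This is the comparison of the two constants with 1 subtracted from each and the
    positive denominator cleared; the gap is \<open>(l+4)*(l-1)/2\<close>.\<close>
  have "(real l + 1) * (real l ^ 2 + 3 * real l - 1) \<le> (real l - 1 / 2) * ((real l + 2) * (real l + 3))"
  proof (subst diff_ge_0_iff_ge[symmetric])
    have eq: "(real l - 1 / 2) * ((real l + 2) * (real l + 3))
          - (real l + 1) * (real l ^ 2 + 3 * real l - 1) = (real l ^ 2 + 3 * real l - 4) / 2"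
      by (simp add: field_simps power2_eq_square)
    show "0 \<le> (real l - 1 / 2) * ((real l + 2) * (real l + 3))
        - (real l + 1) * (real l ^ 2 + 3 * real l - 1)"
      unfolding eq using l_real zero_le_power2[of "real l"] by (intro divide_nonneg_nonneg) linarith+
  qed
  then have "(real l + 1) * (real l ^ 2 + 3 * real l - 1) / ((real l + 2) * (real l + 3)) \<le> real l - 1 / 2"
    by (subst pos_divide_le_eq) simp_all
  then have "kemeny (add_clique G A) \<le> kemeny G"
    unfolding kemeny_eq kemeny_add_part by simp
  with edge show ?thesis
    using pair_graph connected coclique
    by (auto simp: braess_edge_def braess_clique_def not_less)
qed

end
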